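(* The following identity holds: $$\sum_{k=1}^\infty\frac{2^k H_{k-1}^{(2)}}{k\binom{2k}{k}}=\frac{\pi^3}{48}.$$
   Context: For $n=0,1,2,\ldots$, $H_n^{(2)}:=\sum_{0<k\leqslant n}\frac{1}{k^2}$ denotes the second-order harmonic number (so $H_0^{(2)}=0$). *)

theory Defs
  imports "HOL-Analysis.Analysis"
begin

definition harm2 :: "nat \<Rightarrow> real" where
  "harm2 n = (\<Sum>k\<in>{0<..n}. 1 / real k ^ 2)"

end

theory Submission
  imports Defs
begin

text \<open>
  With \<open>coef j = 4 ^ (j + 1) / ((j + 1) * ((2 * j + 2) choose (j + 1)))\<close> one has
  \<open>(\<Sum>j. coef j * harm2 j * sin \<theta> ^ (2 * j + 1) * cos \<theta>) = 4 / 3 * \<theta> ^ 3\<close> for \<open>0 \<le> \<theta> < pi / 2\<close>, and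
  \<open>\<theta> = pi / 4\<close> gives the theorem. Because \<open>(2 * j + 3) * coef (j + 1) = (2 * j + 2) * coef j\<close>, the
  derivative in \<open>\<theta>\<close> of a partial sum telescopes to twice a partial sum of
  \<open>\<Sum>j. coef j / (j + 1) * sin \<theta> ^ (2 * j + 2) = 2 * \<theta>\<^sup>2\<close>, up to a boundary term that decays
  geometrically; two further differentiations reduce that series to a constant in the same way.
  So only finite sums are differentiated, and the boundary terms are integrated back by the mean
  value inequality.
\<close>

definition coef :: "nat \<Rightarrow> real" where
  "coef j = 4 ^ Suc j / (real (Suc j) * real ((2 * Suc j) choose Suc j))"

definition boundary :: "nat \<Rightarrow> real \<Rightarrow> real" where
  "boundary n x = real (2 * n + 1) * coef n * sin x ^ (2 * n)"

section \<open>Recurrence and bounds for the central binomial coefficients\<close>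

lemma coef_0: "coef 0 = 2"
  by (simp add: coef_def numeral_2_eq_2)

text \<open>With \<open>k = j + 1\<close> this is the ratio of consecutive central binomial
  coefficients, \<open>2 * (2 * k + 1) / (k + 1)\<close>, in which the powers of 4 and the factors
  \<open>k\<close> and \<open>k + 1\<close> are absorbed.\<close>

lemma coef_Suc: "(2 * real j + 3) * coef (Suc j) = (2 * real j + 2) * coef j"
proof -
  define c where "c = real ((2 * Suc j) choose Suc j)"
  have "Suc (Suc j) * ((2 * Suc (Suc j)) choose Suc (Suc j)) = 2 * (2 * j + 3) * ((2 * Suc j) choose Suc j)"
  proof -
    have "Suc (Suc j) * ((2 * Suc (Suc j)) choose Suc (Suc j)) =
        (2 * j + 4) * ((2 * j + 3) choose Suc j)"
      using Suc_times_binomial_eq[of "2 * j + 3" "Suc j"]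
      by (simp add: algebra_simps eval_nat_numeral del: binomial_Suc_Suc)
    also have "(2 * j + 3) choose Suc j = (2 * j + 3) choose Suc (Suc j)"
      using binomial_symmetric[of "Suc j" "2 * j + 3"]
      by (simp add: eval_nat_numeral del: binomial_Suc_Suc)
    also have "(2 * j + 4) * \<dots> = 2 * (Suc (Suc j) * ((2 * j + 3) choose Suc (Suc j)))"
      by (simp add: algebra_simps del: binomial_Suc_Suc)
    also have "Suc (Suc j) * ((2 * j + 3) choose Suc (Suc j)) = (2 * j + 3) * ((2 * Suc j) choose Suc j)"
      using Suc_times_binomial_eq[of "2 * j + 2" "Suc j"]
      by (simp add: algebra_simps eval_nat_numeral del: binomial_Suc_Suc)
    finally show ?thesis
      by (simp add: mult.assoc del: binomial_Suc_Suc)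
  qed
  from arg_cong[OF this, of real]
  have "real (Suc (Suc j)) * real ((2 * Suc (Suc j)) choose Suc (Suc j)) = 2 * (2 * real j + 3) * c"
    unfolding c_def of_nat_mult by simp
  then have "coef (Suc j) = 4 ^ Suc (Suc j) / (2 * (2 * real j + 3) * c)"
    unfolding coef_def by simp
  moreover have "d * (a / (2 * d * c)) = a / (2 * c)" if "d \<noteq> 0" for a d :: real
    using that by simp
  ultimately have "(2 * real j + 3) * coef (Suc j) = 4 ^ Suc (Suc j) / (2 * c)"
    by (simp only:)
  moreover have "coef j = 4 ^ Suc j / ((real j + 1) * c)"
    unfolding coef_def c_def by (simp add: add.commute)
  then have "(real j + 1) * coef j = 4 ^ Suc j / c"
    by simp
  ultimately show ?thesis
    by (simp add: algebra_simps)
qed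

lemma coef_bounds: "0 \<le> coef j" "coef j \<le> 2"
proof -
  show nonneg: "0 \<le> coef j" for j
    by (simp add: coef_def)
  show "coef j \<le> 2"
  proof (induction j)
    case (Suc j)
    have "(2 * real j + 3) * coef (Suc j) \<le> (2 * real j + 3) * coef j"
      using nonneg[of j] by (simp add: coef_Suc mult_right_mono)
    then have "coef (Suc j) \<le> coef j"
      by (rule mult_left_le_imp_le) simp
    with Suc show ?case by simp
  qed (simp add: coef_0)
qed

text \<open>The recurrence turns \<open>(2 * j + 2) * coef j\<close> into
  \<open>(2 * j + 3) * coef (Suc j)\<close>, the leading factor of \<open>boundary (Suc j)\<close>.
  The left side is the derivative of a single summand, so sums of such derivatives
  telescope.\<close>

lemma boundary_diff:
  "coef j * (real (2 * j + 1) * sin x ^ (2 * j) - real (2 * j + 2) * sin x ^ (2 * j + 2))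
    = boundary j x - boundary (Suc j) x"
proof -
  have "boundary (Suc j) x = (2 * real j + 2) * coef j * sin x ^ (2 * j + 2)"
    unfolding coef_Suc[symmetric] boundary_def by (simp add: algebra_simps)
  then show ?thesis
    by (simp add: boundary_def algebra_simps)
qed

text \<open>Monotonicity of sine on \<open>{0..T}\<close> makes the bound uniform in
  \<open>x\<close>; the constant is \<open>2 * (2 * n + 1)\<close>, from
  \<open>coef n \<le> 2\<close>.\<close>

lemma abs_boundary_le:
  assumes "0 \<le> x" "x \<le> T" "T < pi / 2"
  shows "\<bar>boundary n x\<bar> \<le> (4 * real n + 2) * sin T ^ (2 * n)"
proof -
  have "0 \<le> sin x" "sin x \<le> sin T"
    using assms by (auto intro!: sin_ge_zero sin_monotone_2pi_le)
  then show ?thesis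
    unfolding boundary_def abs_mult power_abs
    using coef_bounds[of n] mult_mono[of "coef n" 2 "sin x ^ (2 * n)" "sin T ^ (2 * n)"]
      mult_left_mono[of "coef n * sin x ^ (2 * n)" "2 * sin T ^ (2 * n)" "2 * real n + 1"]
    by (simp add: power_mono algebra_simps)
qed

section \<open>Second-order harmonic numbers\<close>

lemma harm2_0: "harm2 0 = 0"
  by (simp add: harm2_def)

lemma harm2_Suc: "harm2 (Suc n) = harm2 n + 1 / (real n + 1) ^ 2"
proof -
  have "{0<..Suc n} = insert (Suc n) {0<..n}" by auto
  then show ?thesis by (simp add: harm2_def add.commute)
qed

lemma harm2_bounds: "0 \<le> harm2 n" "harm2 n \<le> real n"
proof -
  show "0 \<le> harm2 n" by (simp add: harm2_def sum_nonneg)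
  show "harm2 n \<le> real n"
  proof (induction n)
    case (Suc n)
    have "1 / (real n + 1) ^ 2 \<le> 1" by simp
    with Suc show ?case unfolding harm2_Suc of_nat_Suc by linarith
  qed (simp add: harm2_0)
qed

section \<open>Derivatives of the partial sums\<close>

lemma DERIV_sin_power:
  "((\<lambda>x::real. sin x ^ Suc m) has_real_derivative (1 + real m) * (cos x * sin x ^ m)) (at x within S)"
  by (intro DERIV_power_Suc) (auto intro!: derivative_eq_intros)

lemma DERIV_sin_power_cos:
  "((\<lambda>x::real. sin x ^ (2 * j + 1) * cos x) has_real_derivative
    real (2 * j + 1) * sin x ^ (2 * j) - real (2 * j + 2) * sin x ^ (2 * j + 2)) (at x within S)"
proof -
  have cos2: "cos x * cos x = 1 - sin x * sin x"
    using sin_cos_squared_add[of x] by (simp add: power2_eq_square)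
  have "((\<lambda>x::real. sin x ^ (2 * j + 1) * cos x) has_real_derivative
    real (2 * j + 1) * sin x ^ (2 * j) * (cos x * cos x) - sin x ^ (2 * j + 2)) (at x within S)"
    using DERIV_mult[OF DERIV_sin_power[of "2 * j"] DERIV_subset[OF DERIV_cos subset_UNIV]]
    by (simp add: algebra_simps)
  then show ?thesis
    unfolding cos2 by (rule DERIV_cong) (simp add: algebra_simps)
qed

text \<open>The telescoped sum starts from \<open>boundary 0 x = coef 0 = 2\<close>. This is the
  arcsine series in trigonometric form: the sums tend to \<open>2 * x\<close>.\<close>

lemma DERIV_sum_coef:
  "((\<lambda>x. \<Sum>j<n. coef j * (sin x ^ (2 * j + 1) * cos x)) has_real_derivative
    2 - boundary n x) (at x within S)"
proof -
  have "((\<lambda>x. \<Sum>j<n. coef j * (sin x ^ (2 * j + 1) * cos x)) has_real_derivative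
    (\<Sum>j<n. boundary j x - boundary (Suc j) x)) (at x within S)"
    unfolding boundary_diff[symmetric] by (intro DERIV_sum DERIV_cmult DERIV_sin_power_cos)
  then show ?thesis
    unfolding sum_lessThan_telescope'[of "\<lambda>j. boundary j x"] by (simp add: boundary_def coef_0)
qed

lemma DERIV_sum_coef_div:
  "((\<lambda>x. \<Sum>j<n. coef j / real (Suc j) * sin x ^ (2 * j + 2)) has_real_derivative
    2 * (\<Sum>j<n. coef j * (sin x ^ (2 * j + 1) * cos x))) (at x within S)"
  unfolding sum_distrib_left
proof (intro DERIV_sum)
  fix j
  have "((\<lambda>x. coef j / real (Suc j) * sin x ^ (2 * j + 2)) has_real_derivative
    coef j / real (Suc j) * ((1 + real (2 * j + 1)) * (cos x * sin x ^ (2 * j + 1)))) (at x within S)"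
    using DERIV_cmult[OF DERIV_sin_power[of "2 * j + 1" x S], of "coef j / real (Suc j)"] by simp
  then show "((\<lambda>x. coef j / real (Suc j) * sin x ^ (2 * j + 2)) has_real_derivative
    2 * (coef j * (sin x ^ (2 * j + 1) * cos x))) (at x within S)"
    by (rule DERIV_cong) (simp add: divide_simps)
qed

lemma DERIV_sum_coef_harm2:
  "((\<lambda>x. \<Sum>j<n. coef j * harm2 j * (sin x ^ (2 * j + 1) * cos x)) has_real_derivative
    2 * (\<Sum>j<n. coef j / real (Suc j) * sin x ^ (2 * j + 2)) - harm2 n * boundary n x)
    (at x within S)"
proof -
  \<comment> \<open>Summation by parts: the increment \<open>1 / (n + 1) ^ 2\<close> of
    \<open>harm2\<close> meets \<open>boundary (Suc n) x\<close>, whose factor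
    \<open>2 * (n + 1)\<close> cancels one power of \<open>n + 1\<close>. The initial term vanishes
    because \<open>harm2 0 = 0\<close>.\<close>
  have abel: "(\<Sum>j<n. harm2 j * (boundary j x - boundary (Suc j) x)) =
    2 * (\<Sum>j<n. coef j / real (Suc j) * sin x ^ (2 * j + 2)) - harm2 n * boundary n x"
  proof (induction n)
    case (Suc n)
    have "boundary (Suc n) x = (2 * real n + 2) * coef n * sin x ^ (2 * n + 2)"
      unfolding coef_Suc[symmetric] boundary_def by (simp add: algebra_simps)
    then have "boundary (Suc n) x / (real n + 1) ^ 2 = 2 * (coef n / real (Suc n) * sin x ^ (2 * n + 2))"
      by (simp add: divide_simps power2_eq_square) (simp add: algebra_simps)
    with Suc show ?case
      by (simp add: harm2_Suc algebra_simps)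
  qed (simp add: harm2_0)
  have "((\<lambda>x. \<Sum>j<n. harm2 j * (coef j * (sin x ^ (2 * j + 1) * cos x))) has_real_derivative
    (\<Sum>j<n. harm2 j * (boundary j x - boundary (Suc j) x))) (at x within S)"
    unfolding boundary_diff[symmetric] by (intro DERIV_sum DERIV_cmult DERIV_sin_power_cos)
  then show ?thesis
    unfolding abel by (simp add: mult_ac)
qed

section \<open>Mean value estimates and passage to the limit\<close>

lemma abs_le_of_abs_deriv_le:
  fixes f :: "real \<Rightarrow> real"
  assumes "\<And>x. x \<in> {0..T} \<Longrightarrow> (f has_real_derivative f' x) (at x within {0..T})"
    and "\<And>x. x \<in> {0..T} \<Longrightarrow> \<bar>f' x\<bar> \<le> B" and "f 0 = 0" and "x \<in> {0..T}"
  shows "\<bar>f x\<bar> \<le> B * T"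
proof -
  have "norm (f x - f 0) \<le> B * norm (x - 0)"
    using assms(4) by (intro field_differentiable_bound[where S = "{0..T}" and f' = f'])
      (auto intro!: assms(1) simp del: atLeastAtMost_iff simp: assms(2), auto)
  \<comment> \<open>Here \<open>B\<close> is nonnegative because it bounds an absolute value at
    \<open>x\<close>.\<close>
  also have "\<dots> \<le> B * T"
    using assms(2)[OF assms(4)] assms(4) by (auto intro!: mult_left_mono)
  finally show ?thesis using assms(3) by simp
qed

theorem sums_coef_harm2_sin_cos:
  assumes "0 \<le> T" "T < pi / 2"
  shows "(\<lambda>j. coef j * harm2 j * (sin T ^ (2 * j + 1) * cos T)) sums (4 / 3 * T ^ 3)"
proof -
  define e where "e n = (4 * real n + 2) * sin T ^ (2 * n)" for n
  have boundary_le: "\<bar>boundary n x\<bar> \<le> e n" if "x \<in> {0..T}" for n x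
    using that assms abs_boundary_le[of x T n] by (simp add: e_def)
  \<comment> \<open>Three integrations from 0 follow; each bounds the error of the next uniformly on
    \<open>{0..T}\<close> at the cost of a factor \<open>T\<close>.\<close>
  have first: "\<bar>(\<Sum>j<n. coef j * (sin x ^ (2 * j + 1) * cos x)) - 2 * x\<bar> \<le> e n * T"
    if "x \<in> {0..T}" for n x
  proof (rule abs_le_of_abs_deriv_le[OF _ _ _ that])
    fix x
    show "((\<lambda>x. (\<Sum>j<n. coef j * (sin x ^ (2 * j + 1) * cos x)) - 2 * x)
      has_real_derivative - boundary n x) (at x within {0..T})"
      by (rule derivative_eq_intros DERIV_sum_coef refl)+ simp
    assume "x \<in> {0..T}"
    then show "\<bar>- boundary n x\<bar> \<le> e n"
      by (simp add: boundary_le)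
  qed simp
  have second: "\<bar>(\<Sum>j<n. coef j / real (Suc j) * sin x ^ (2 * j + 2)) - 2 * x ^ 2\<bar> \<le> 2 * (e n * T) * T"
    if "x \<in> {0..T}" for n x
  proof (rule abs_le_of_abs_deriv_le[OF _ _ _ that])
    fix x
    show "((\<lambda>x. (\<Sum>j<n. coef j / real (Suc j) * sin x ^ (2 * j + 2)) - 2 * x ^ 2)
      has_real_derivative 2 * ((\<Sum>j<n. coef j * (sin x ^ (2 * j + 1) * cos x)) - 2 * x))
      (at x within {0..T})"
      by (rule derivative_eq_intros DERIV_sum_coef_div refl)+ (simp add: algebra_simps)
    assume "x \<in> {0..T}"
    from first[OF this, of n]
    show "\<bar>2 * ((\<Sum>j<n. coef j * (sin x ^ (2 * j + 1) * cos x)) - 2 * x)\<bar> \<le> 2 * (e n * T)"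
      by (simp only: abs_mult) simp
  qed simp
  \<comment> \<open>The error in the derivative is twice that of \<open>second\<close> plus the
    weighted boundary term, where \<open>harm2 n \<le> n\<close> suffices against geometric
    decay.\<close>
  have third: "\<bar>(\<Sum>j<n. coef j * harm2 j * (sin x ^ (2 * j + 1) * cos x)) - 4 / 3 * x ^ 3\<bar>
      \<le> (2 * (2 * (e n * T) * T) + real n * e n) * T"
    if "x \<in> {0..T}" for n x
  proof (rule abs_le_of_abs_deriv_le[OF _ _ _ that])
    fix x
    show "((\<lambda>x. (\<Sum>j<n. coef j * harm2 j * (sin x ^ (2 * j + 1) * cos x)) - 4 / 3 * x ^ 3)
      has_real_derivative
        2 * ((\<Sum>j<n. coef j / real (Suc j) * sin x ^ (2 * j + 2)) - 2 * x ^ 2) - harm2 n * boundary n x)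
      (at x within {0..T})"
      by (rule derivative_eq_intros DERIV_sum_coef_harm2 refl)+ (simp add: algebra_simps)
    assume x: "x \<in> {0..T}"
    have tail_le: "\<bar>harm2 n * boundary n x\<bar> \<le> real n * e n"
      unfolding abs_mult using harm2_bounds[of n] boundary_le[OF x, of n]
      by (intro mult_mono) auto
    have "\<bar>2 * u - v\<bar> \<le> 2 * a + b" if "\<bar>u\<bar> \<le> a" "\<bar>v\<bar> \<le> b" for u v a b :: real
      using that by linarith
    from this[OF second[OF x, of n] tail_le]
    show "\<bar>2 * ((\<Sum>j<n. coef j / real (Suc j) * sin x ^ (2 * j + 2)) - 2 * x ^ 2) - harm2 n * boundary n x\<bar>
        \<le> 2 * (2 * (e n * T) * T) + real n * e n" .
  qed simp
  have sin_T: "\<bar>sin T\<bar> < 1"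
    using assms sin_monotone_2pi[of T "pi / 2"] sin_ge_zero[of T] by simp
  have lim: "(\<lambda>n. real n * sin T ^ n) \<longlonglongrightarrow> 0" "(\<lambda>n. sin T ^ n) \<longlonglongrightarrow> 0"
    using powser_times_n_limit_0[of "sin T"] LIMSEQ_power_zero[of "sin T"] sin_T by simp_all
  \<comment> \<open>Splitting the even power gives each of the up to two factors \<open>n\<close> in
    \<open>n * e n\<close> its own \<open>sin T ^ n\<close>, so both limits in \<open>lim\<close>
    apply.\<close>
  have sin_double_power: "sin T ^ (2 * n) = sin T ^ n * sin T ^ n" for n
    by (simp only: mult_2 power_add)
  have "e = (\<lambda>n. 4 * (real n * sin T ^ n) * sin T ^ n + 2 * sin T ^ n * sin T ^ n)"
    unfolding e_def sin_double_power by (simp add: fun_eq_iff algebra_simps)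
  moreover have "\<dots> \<longlonglongrightarrow> 4 * 0 * 0 + 2 * 0 * 0"
    by (intro tendsto_intros lim)
  ultimately have e_lim: "e \<longlonglongrightarrow> 0" by simp
  have "(\<lambda>n. real n * e n) =
      (\<lambda>n. 4 * (real n * sin T ^ n) * (real n * sin T ^ n) + 2 * (real n * sin T ^ n) * sin T ^ n)"
    unfolding e_def sin_double_power by (simp add: fun_eq_iff algebra_simps)
  moreover have "\<dots> \<longlonglongrightarrow> 4 * 0 * 0 + 2 * 0 * 0"
    by (intro tendsto_intros lim)
  ultimately have ne_lim: "(\<lambda>n. real n * e n) \<longlonglongrightarrow> 0" by simp
  have "(\<lambda>n. (2 * (2 * (e n * T) * T) + real n * e n) * T) \<longlonglongrightarrow> (2 * (2 * (0 * T) * T) + 0) * T"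
    by (intro tendsto_intros e_lim ne_lim)
  then have "(\<lambda>n. (2 * (2 * (e n * T) * T) + real n * e n) * T) \<longlonglongrightarrow> 0"
    by simp
  then have "(\<lambda>n. (\<Sum>j<n. coef j * harm2 j * (sin T ^ (2 * j + 1) * cos T)) - 4 / 3 * T ^ 3) \<longlonglongrightarrow> 0"
    by (rule Lim_null_comparison[rotated]) (use third[of T] assms in simp)
  then show ?thesis
    unfolding sums_def by (rule LIM_zero_cancel)
qed

theorem theorem1p1:
  shows "(\<lambda>j. let k = Suc j in 2 ^ k * harm2 (k - 1) / (real k * real ((2 * k) choose k)))
           sums (pi ^ 3 / 48)"
proof -
  have "coef j * harm2 j * (sin (pi / 4) ^ (2 * j + 1) * cos (pi / 4)) =
      (let k = Suc j in 2 ^ k * harm2 (k - 1) / (real k * real ((2 * k) choose k)))" for j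
  proof -
    \<comment> \<open>At \<open>pi / 4\<close> sine and cosine agree, so the cosine completes the
      odd power to \<open>2 * (j + 1)\<close>. The resulting \<open>1 / 2 ^ Suc j\<close> reduces
      the \<open>4 ^ Suc j\<close> in \<open>coef j\<close> to \<open>2 ^ Suc j\<close>.\<close>
    have "sin (pi / 4) ^ (2 * j + 1) * cos (pi / 4) = ((sqrt 2 / 2) ^ 2) ^ Suc j"
      unfolding power_mult[symmetric] sin_45 cos_45 by simp
    also have "\<dots> = 1 / 2 ^ Suc j"
      by (simp add: power_divide)
    finally have pow: "sin (pi / 4) ^ (2 * j + 1) * cos (pi / 4) = 1 / 2 ^ Suc j" .
    have four: "(4::real) ^ Suc j = 2 ^ Suc j * 2 ^ Suc j"
      unfolding power_mult_distrib[symmetric] by simp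
    show ?thesis
      unfolding pow coef_def four Let_def by (simp del: binomial_Suc_Suc power_Suc mult_Suc_right)
  qed
  moreover have "4 / 3 * (pi / 4) ^ 3 = pi ^ 3 / 48"
    by (simp add: power_divide)
  moreover have "0 \<le> pi / 4" "pi / 4 < pi / 2"
    by simp_all
  ultimately show ?thesis
    using sums_coef_harm2_sin_cos[of "pi / 4"] by (simp only:)
qed

end
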